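(* Let $\beta=\{\beta_n\}_{n=0}^\infty$ be a sequence of positive numbers satisfying $$\limsup_{n\to\infty}(1/\beta_n)^{1/n}\le 1,\qquad \limsup_{n\to\infty}\beta_n^{1/n}\le 1 .$$ Then there exists a sequence $\{\lambda_n\}_{n\ge 1}\subset\mathbb{D}$ such that the system of reproducing kernels $\{K^\beta_{\lambda_n}\}_{n\ge 1}$ is a representing system for the weighted Hardy space $\mathscr{H}_\beta$.
   Context: $\mathbb{D}$ is the open unit disk in $\mathbb{C}$. For a sequence $\beta=\{\beta_n\}_{n\ge0}$ as in the statement, the weighted Hardy space is $$\mathscr{H}_\beta=\Big\{f(z)=\sum_{n=0}^\infty a_nz^n:\ \sum_{n=0}^\infty|a_n|^2\beta_n<\infty\Big\},\qquad \|f\|_\beta^2=\sum_{n=0}^\infty|a_n|^2\beta_n .$$ It is a Hilbert space of functions analytic in $\mathbb{D}$, with reproducing kernel at $\lambda\in\mathbb{D}$ given by $$K^\beta_\lambda(z)=\sum_{n=0}^\infty\frac{\bar\lambda^n}{\beta_n}z^n .$$ A sequence $\{x_n\}_{n\ge 1}$ in a separable infinite-dimensional Banach space $X$ is a representing system for $X$ if for every $x\in X$ there exists a sequence of complex numbers $\{c_n\}_{n\ge1}$ (not necessarily unique) such that $x=\sum_{n\ge 1}c_nx_n$, where the sequence of partial sums of the series, taken in the given order, converges to $x$ in the norm of $X$. *)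

theory Defs
  imports "HOL-Complex_Analysis.Complex_Analysis"
begin

text \<open>
  The weighted Hardy space is a set of functions on the open unit disk. Since HOL functions are
  total, such functions are extended by 0 to the whole plane; with this convention the set is
  closed under the pointwise vector space operations, and equality of functions is equality on
  the disk.
\<close>

definition weighted_hardy :: "(nat \<Rightarrow> real) \<Rightarrow> (complex \<Rightarrow> complex) set" where
  "weighted_hardy \<beta> =
     {f. (\<exists>a. summable (\<lambda>n. (cmod (a n))\<^sup>2 * \<beta> n) \<and>
              (\<forall>z\<in>ball 0 1. (\<lambda>n. a n * z ^ n) sums f z)) \<and>
         (\<forall>z. z \<notin> ball 0 1 \<longrightarrow> f z = 0)}"

text \<open>
  The coefficients of an element of the space are its Taylor coefficients at 0; see lemma
  \<open>fps_expansion_coeff_eq\<close> below. The value of the norm is only meaningful on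
  \<^const>\<open>weighted_hardy\<close>.
\<close>

definition hardy_norm :: "(nat \<Rightarrow> real) \<Rightarrow> (complex \<Rightarrow> complex) \<Rightarrow> real" where
  "hardy_norm \<beta> f = sqrt (\<Sum>n. (cmod (fps_nth (fps_expansion f 0) n))\<^sup>2 * \<beta> n)"

definition hardy_kernel :: "(nat \<Rightarrow> real) \<Rightarrow> complex \<Rightarrow> complex \<Rightarrow> complex" where
  "hardy_kernel \<beta> w z =
     (if z \<in> ball 0 1 then \<Sum>n. cnj w ^ n / of_real (\<beta> n) * z ^ n else 0)"

text \<open>
  Representing systems in a complex normed space of functions with carrier \<open>X\<close>, norm \<open>N\<close> and
  pointwise operations. The system is indexed by \<open>n \<ge> 1\<close>; the value \<open>x 0\<close> is irrelevant.
\<close>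

definition representing_system ::
    "('a \<Rightarrow> complex) set \<Rightarrow> (('a \<Rightarrow> complex) \<Rightarrow> real) \<Rightarrow> (nat \<Rightarrow> 'a \<Rightarrow> complex) \<Rightarrow> bool" where
  "representing_system X N x \<longleftrightarrow>
     (\<forall>n\<ge>1. x n \<in> X) \<and>
     (\<forall>f\<in>X. \<exists>c. (\<lambda>m. N (\<lambda>z. f z - (\<Sum>n=1..m. c n * x n z))) \<longlonglongrightarrow> 0)"

lemma fps_expansion_coeff_eq:
  fixes a :: "nat \<Rightarrow> complex"
  assumes "\<And>z. z \<in> ball 0 1 \<Longrightarrow> (\<lambda>n. a n * z ^ n) sums f z"
  shows "fps_nth (fps_expansion f 0) n = a n"
proof -
  have "fps_conv_radius (Abs_fps a) \<ge> 1"
    unfolding fps_conv_radius_def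
  proof (rule conv_radius_geI_ex)
    fix r :: real assume r: "0 < r" "ereal r < 1"
    have "(of_real r :: complex) \<in> ball 0 1" using r by simp
    from sums_summable[OF assms[OF this]] r
    show "\<exists>z::complex. norm z = r \<and> summable (\<lambda>n. fps_nth (Abs_fps a) n * z ^ n)"
      by (intro exI[of _ "of_real r"]) simp
  qed
  moreover have "eventually (\<lambda>z. z \<in> ball (0::complex) 1) (nhds 0)"
    by (intro eventually_nhds_in_open) auto
  then have "eventually (\<lambda>z. eval_fps (Abs_fps a) z = f z) (nhds 0)"
    by eventually_elim (use assms in \<open>auto simp: eval_fps_def sums_iff\<close>)
  ultimately have "f has_fps_expansion Abs_fps a"
    unfolding has_fps_expansion_def by (auto intro: less_le_trans[of 0 1])
  from fps_nth_fps_expansion[OF this, of n] show ?thesis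
    by (simp add: fps_expansion_def)
qed

lemma hardy_norm_eq:
  assumes "\<And>z. z \<in> ball 0 1 \<Longrightarrow> (\<lambda>n. a n * z ^ n) sums f z"
  shows "hardy_norm \<beta> f = sqrt (\<Sum>n. (cmod (a n))\<^sup>2 * \<beta> n)"
  unfolding hardy_norm_def using fps_expansion_coeff_eq[of a f] assms by simp

lemma weighted_hardy_lincomb:
  assumes f: "f \<in> weighted_hardy \<beta>" and g: "g \<in> weighted_hardy \<beta>" and pos: "\<And>n. 0 < \<beta> n"
  shows "(\<lambda>z. c * f z + d * g z) \<in> weighted_hardy \<beta>"
proof -
  from f obtain a where a: "summable (\<lambda>n. (cmod (a n))\<^sup>2 * \<beta> n)"
    "\<And>z. z \<in> ball 0 1 \<Longrightarrow> (\<lambda>n. a n * z ^ n) sums f z" "\<And>z. z \<notin> ball 0 1 \<Longrightarrow> f z = 0"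
    unfolding weighted_hardy_def by blast
  from g obtain b where b: "summable (\<lambda>n. (cmod (b n))\<^sup>2 * \<beta> n)"
    "\<And>z. z \<in> ball 0 1 \<Longrightarrow> (\<lambda>n. b n * z ^ n) sums g z" "\<And>z. z \<notin> ball 0 1 \<Longrightarrow> g z = 0"
    unfolding weighted_hardy_def by blast
  have le: "(cmod (c * a n + d * b n))\<^sup>2 \<le>
      2 * (cmod c)\<^sup>2 * (cmod (a n))\<^sup>2 + 2 * (cmod d)\<^sup>2 * (cmod (b n))\<^sup>2" for n
  proof -
    have "(cmod (c * a n + d * b n))\<^sup>2 \<le> (cmod (c * a n) + cmod (d * b n))\<^sup>2"
      by (intro power_mono norm_triangle_ineq) simp
    also have "\<dots> \<le> 2 * (cmod (c * a n))\<^sup>2 + 2 * (cmod (d * b n))\<^sup>2"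
      using sum_squares_bound[of "cmod (c * a n)" "cmod (d * b n)"]
      by (simp add: power2_sum)
    finally show ?thesis by (simp add: norm_mult power_mult_distrib)
  qed
  have "summable (\<lambda>n. (2 * (cmod c)\<^sup>2) * ((cmod (a n))\<^sup>2 * \<beta> n) +
      (2 * (cmod d)\<^sup>2) * ((cmod (b n))\<^sup>2 * \<beta> n))"
    by (intro summable_add summable_mult a b)
  then have "summable (\<lambda>n. (cmod (c * a n + d * b n))\<^sup>2 * \<beta> n)"
  proof (rule summable_comparison_test'[where N = 0])
    fix n
    show "norm ((cmod (c * a n + d * b n))\<^sup>2 * \<beta> n) \<le>
        (2 * (cmod c)\<^sup>2) * ((cmod (a n))\<^sup>2 * \<beta> n) + (2 * (cmod d)\<^sup>2) * ((cmod (b n))\<^sup>2 * \<beta> n)"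
      using mult_right_mono[OF le[of n], of "\<beta> n"] pos[of n] by (simp add: algebra_simps)
  qed
  moreover have "(\<lambda>n. (c * a n + d * b n) * z ^ n) sums (c * f z + d * g z)" if "z \<in> ball 0 1" for z
    using sums_add[OF sums_mult[OF a(2)[OF that], of c] sums_mult[OF b(2)[OF that], of d]]
    by (simp add: algebra_simps)
  ultimately show ?thesis
    unfolding weighted_hardy_def using a(3) b(3)
    by (intro CollectI conjI exI[of _ "\<lambda>n. c * a n + d * b n"]) auto
qed

end

theory Submission
  imports Defs
begin

text \<open>
  A system of kernels with dense linear span becomes a representing system once its members are
  repeated suitably often. Block \<open>k\<close> of the sequence lists the first \<open>k + 1\<close> kernels \<open>M\<^sub>k\<close> times.
  Given \<open>f\<close>, choose approximants \<open>y\<^sub>k \<rightarrow> f\<close> in the span of the first \<open>k\<close> kernels, with coefficients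
  bounded by \<open>k\<close>, and add \<open>y\<^bsub>k+1\<^esub> - y\<^sub>k\<close> in block \<open>k\<close> by using \<open>1 / M\<^sub>k\<close> of its
  coefficients in each repetition. The partial sums then stay close to the segment from
  \<open>y\<^sub>k\<close> to \<open>y\<^bsub>k+1\<^esub>\<close>, because an incomplete repetition contributes at most
  \<open>O(1 / M\<^sub>k)\<close>, with a constant that depends on \<open>k\<close> but not on \<open>f\<close>.

  The kernels at the points \<open>\<frac12>e\<^bsup>2\<pi>ij/N\<^esup>\<close> have dense span: a discrete Fourier transform of
  length \<open>N\<close> yields a combination with prescribed Taylor coefficients of index less than \<open>N\<close>, whose
  remaining coefficients form a tail dominated by that of a single kernel.
\<close>

section \<open>Periodic finite sums and the division of the naturals into blocks\<close>

lemma sum_lessThan_add: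
  fixes g :: "nat \<Rightarrow> 'a::comm_monoid_add"
  shows "sum g {..<m + n} = sum g {..<m} + (\<Sum>i<n. g (m + i))"
  by (induction n) (simp_all add: add_ac)

lemma sum_mod_periodic:
  fixes g :: "nat \<Rightarrow> 'a::comm_semiring_1"
  assumes "t \<le> p"
  shows "(\<Sum>i<s * p + t. g (i mod p)) = of_nat s * sum g {..<p} + sum g {..<t}"
proof (induction s)
  case 0
  then show ?case using assms by simp
next
  case (Suc s)
  have "(\<Sum>i<Suc s * p + t. g (i mod p)) = (\<Sum>i<p. g (i mod p)) + (\<Sum>i<s * p + t. g ((p + i) mod p))"
    using sum_lessThan_add[of "\<lambda>i. g (i mod p)" p "s * p + t"] by (simp add: add_ac)
  also have "(\<Sum>i<p. g (i mod p)) = sum g {..<p}"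
    by (intro sum.cong) auto
  finally show ?case using Suc by (simp add: algebra_simps)
qed

text \<open>Positive lengths make the block starts \<open>sum L {..<k}\<close> strictly increasing,
  so every \<open>n\<close> lies in exactly one block; \<open>B n\<close> is its number, counted
  from 0.\<close>

lemma block_decomposition:
  fixes L :: "nat \<Rightarrow> nat"
  assumes "\<And>k. 0 < L k"
  obtains B :: "nat \<Rightarrow> nat"
  where "\<And>n. sum L {..<B n} \<le> n" "\<And>n. n < sum L {..<B n} + L (B n)"
    "\<And>k i. i < L k \<Longrightarrow> B (sum L {..<k} + i) = k" "filterlim B at_top sequentially"
proof -
  define T where "T k = sum L {..<k}" for k
  have T_Suc: "T (Suc k) = T k + L k" for k by (simp add: T_def)
  have sm: "strict_mono T" using assms by (simp add: strict_mono_Suc_iff T_Suc)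
  define B where "B n = (LEAST k. n < T (Suc k))" for n
  have up: "n < T (Suc (B n))" for n
    unfolding B_def
    by (rule LeastI[of _ n]) (metis Suc_le_lessD sm strict_mono_imp_increasing)
  have lo: "T (B n) \<le> n" for n
  proof (cases "B n")
    case 0
    then show ?thesis by (simp add: T_def)
  next
    case (Suc k)
    then have "\<not> n < T (Suc k)" unfolding B_def by (intro not_less_Least) simp
    then show ?thesis using Suc by simp
  qed
  have uniq: "B n = k" if "T k \<le> n" "n < T (Suc k)" for n k
  proof -
    have "T k < T (Suc (B n))" "T (B n) < T (Suc k)" using that up[of n] lo[of n] by linarith+
    then have "k < Suc (B n)" "B n < Suc k" using strict_mono_less[OF sm] by blast+
    then show ?thesis by simp
  qed
  have "eventually (\<lambda>n. K \<le> B n) sequentially" for K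
    using eventually_ge_at_top[of "T K"]
  proof eventually_elim
    case (elim n)
    then have "T K < T (Suc (B n))" using up[of n] by linarith
    then show ?case using strict_mono_less[OF sm] by simp
  qed
  then have "filterlim B at_top sequentially" by (simp add: filterlim_at_top)
  with that[of B] up lo uniq show thesis by (simp add: T_Suc) (simp add: T_def)
qed

section \<open>From dense spans to representing systems in seminormed function spaces\<close>

locale function_seminorm =
  fixes X :: "('a \<Rightarrow> complex) set" and N :: "('a \<Rightarrow> complex) \<Rightarrow> real"
  assumes zero: "(\<lambda>_. 0) \<in> X"
    and lincomb: "f \<in> X \<Longrightarrow> g \<in> X \<Longrightarrow> (\<lambda>z. c * f z + d * g z) \<in> X"
    and triangle: "f \<in> X \<Longrightarrow> g \<in> X \<Longrightarrow> N (\<lambda>z. f z + g z) \<le> N f + N g"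
    and scale: "f \<in> X \<Longrightarrow> N (\<lambda>z. c * f z) = cmod c * N f"
    and nonneg: "f \<in> X \<Longrightarrow> 0 \<le> N f"
begin

lemma add_mem: "f \<in> X \<Longrightarrow> g \<in> X \<Longrightarrow> (\<lambda>z. f z + g z) \<in> X"
  using lincomb[of f g 1 1] by simp

lemma scale_mem: "f \<in> X \<Longrightarrow> (\<lambda>z. c * f z) \<in> X"
  using lincomb[of f f c 0] by simp

lemma diff_mem: "f \<in> X \<Longrightarrow> g \<in> X \<Longrightarrow> (\<lambda>z. f z - g z) \<in> X"
  using lincomb[of f g 1 "-1"] by simp

lemma norm_zero: "N (\<lambda>_. 0) = 0"
  using scale[OF zero, of 0] by simp

lemma sum_mem: "(\<And>i. i \<in> A \<Longrightarrow> g i \<in> X) \<Longrightarrow> (\<lambda>z. \<Sum>i\<in>A. c i * g i z) \<in> X"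
  by (induction A rule: infinite_finite_induct) (simp_all add: zero add_mem scale_mem)

lemma norm_sum_le:
  "(\<And>i. i \<in> A \<Longrightarrow> g i \<in> X) \<Longrightarrow> N (\<lambda>z. \<Sum>i\<in>A. c i * g i z) \<le> (\<Sum>i\<in>A. cmod (c i) * N (g i))"
proof (induction A rule: infinite_finite_induct)
  case (insert i A)
  have "N (\<lambda>z. c i * g i z + (\<Sum>i\<in>A. c i * g i z)) \<le>
      N (\<lambda>z. c i * g i z) + N (\<lambda>z. \<Sum>i\<in>A. c i * g i z)"
    using insert.prems by (intro triangle scale_mem sum_mem) auto
  then show ?case using insert scale[of "g i" "c i"] by simp
qed (simp_all add: norm_zero)

text \<open>Splits the error of a partial sum: \<open>f\<close> and \<open>g\<close> will be the
  errors of two consecutive approximants, weighted by a point on the segment between them, and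
  \<open>h\<close> an incomplete repetition. The weights can be estimated by 1 because both errors
  tend to 0.\<close>

lemma convex_lincomb_le:
  assumes "f \<in> X" "g \<in> X" "h \<in> X" "cmod a \<le> 1" "cmod b \<le> 1"
  shows "N (\<lambda>z. a * f z + b * g z + c * h z) \<le> N f + N g + cmod c * N h"
proof -
  have "N (\<lambda>z. a * f z + b * g z + c * h z) \<le> N (\<lambda>z. a * f z + b * g z) + N (\<lambda>z. c * h z)"
    by (intro triangle lincomb scale_mem assms)
  also have "N (\<lambda>z. a * f z + b * g z) \<le> N (\<lambda>z. a * f z) + N (\<lambda>z. b * g z)"
    by (intro triangle scale_mem assms)
  also have "N (\<lambda>z. a * f z) \<le> N f" "N (\<lambda>z. b * g z) \<le> N g"
    using assms by (simp_all add: scale mult_left_le_one_le nonneg)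
  ultimately show ?thesis using scale[OF \<open>h \<in> X\<close>, of c] by linarith
qed

definition dense_span :: "(nat \<Rightarrow> 'a \<Rightarrow> complex) \<Rightarrow> bool" where
  "dense_span e \<longleftrightarrow>
     (\<forall>f\<in>X. \<forall>\<epsilon>>0. \<exists>A c. finite A \<and> N (\<lambda>z. f z - (\<Sum>j\<in>A. c j * e j z)) < \<epsilon>)"

text \<open>The admissible coefficient sets \<open>S k\<close> grow with \<open>k\<close> and
  exhaust all finitely supported sequences, so by density the infimum of the error over
  \<open>S k\<close> tends to 0; \<open>a k\<close> comes within \<open>1 / Suc k\<close> of it. The
  bound \<open>real k\<close> does not involve \<open>f\<close>, which allows one sequence of block
  lengths to serve every \<open>f\<close>.\<close>

lemma bounded_approximants:
  assumes e: "\<And>j. e j \<in> X" and "dense_span e" and f: "f \<in> X"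
  obtains a :: "nat \<Rightarrow> nat \<Rightarrow> complex"
  where "\<And>k j. cmod (a k j) \<le> real k" "\<And>k j. k \<le> j \<Longrightarrow> a k j = 0"
    "(\<lambda>k. N (\<lambda>z. f z - (\<Sum>j<k. a k j * e j z))) \<longlonglongrightarrow> 0"
proof -
  define S where "S k = {c :: nat \<Rightarrow> complex. \<forall>j. cmod (c j) \<le> real k \<and> (k \<le> j \<longrightarrow> c j = 0)}"
    for k
  define r where "r k c = N (\<lambda>z. f z - (\<Sum>j<k. c j * e j z))" for k and c :: "nat \<Rightarrow> complex"
  have r0: "0 \<le> r k c" for k c
    unfolding r_def by (intro nonneg diff_mem sum_mem f e)
  have bdd: "bdd_below (r k ` S k)" for k
    using r0 by (intro bdd_belowI[of _ 0]) auto
  have "\<exists>c\<in>S k. r k c < Inf (r k ` S k) + 1 / real (Suc k)" for k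
  proof -
    have "(\<lambda>_. 0) \<in> S k" by (simp add: S_def)
    then have "r k ` S k \<noteq> {}" by blast
    then have "\<exists>x\<in>r k ` S k. x < Inf (r k ` S k) + 1 / real (Suc k)"
      using bdd[of k] by (subst cInf_less_iff[symmetric]) auto
    then show ?thesis by blast
  qed
  then obtain a where a: "a k \<in> S k" "r k (a k) < Inf (r k ` S k) + 1 / real (Suc k)" for k
    by metis
  have "eventually (\<lambda>k. r k (a k) < \<epsilon>) sequentially" if "0 < \<epsilon>" for \<epsilon>
  proof -
    obtain A c where A: "finite A" "N (\<lambda>z. f z - (\<Sum>j\<in>A. c j * e j z)) < \<epsilon> / 2"
      using assms(2) f \<open>0 < \<epsilon>\<close> unfolding dense_span_def by (meson half_gt_zero)
    define c' where "c' j = (if j \<in> A then c j else 0)" for j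
    \<comment> \<open>From \<open>K\<close> on, \<open>k\<close> exceeds every index in
      \<open>A\<close> and every modulus \<open>cmod (c j)\<close>, so \<open>c'\<close> is
      admissible. The inserted 0 covers an empty \<open>A\<close>.\<close>
    define K where "K = Suc (Max (insert 0 A)) + nat \<lceil>\<Sum>j\<in>A. cmod (c j)\<rceil>"
    have cK: "c' \<in> S k" and AK: "A \<subseteq> {..<k}" if "K \<le> k" for k
    proof -
      have "j < k" if "j \<in> A" for j
      proof -
        have "j \<le> Max (insert 0 A)" using A that by simp
        then show ?thesis using \<open>K \<le> k\<close> by (simp add: K_def)
      qed
      then show "A \<subseteq> {..<k}" by auto
      have "cmod (c j) \<le> real k" if "j \<in> A" for j
      proof -
        have "cmod (c j) \<le> (\<Sum>j\<in>A. cmod (c j))" using A that by (intro member_le_sum) auto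
        also have "\<dots> \<le> real K" unfolding K_def by linarith
        finally show ?thesis using \<open>K \<le> k\<close> by linarith
      qed
      with \<open>A \<subseteq> {..<k}\<close> show "c' \<in> S k" by (auto simp: S_def c'_def)
    qed
    have c': "r k c' < \<epsilon> / 2" if "K \<le> k" for k
    proof -
      have "(\<Sum>j<k. c' j * e j z) = (\<Sum>j\<in>A. c j * e j z)" for z
        using AK[OF that] A(1) by (intro sum.mono_neutral_cong_right) (auto simp: c'_def)
      then show ?thesis using A(2) by (simp add: r_def)
    qed
    have "eventually (\<lambda>k. 1 / real (Suc k) < \<epsilon> / 2) sequentially"
      using LIMSEQ_Suc[OF lim_1_over_n[where 'a = real]] \<open>0 < \<epsilon>\<close>
      by (intro order_tendstoD) auto
    then show ?thesis
      using eventually_ge_at_top[of K]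
    proof eventually_elim
      case (elim k)
      have "Inf (r k ` S k) \<le> r k c'" using cK elim bdd by (intro cInf_lower) auto
      with elim c'[of k] a(2)[of k] show ?case by auto
    qed
  qed
  then have "(\<lambda>k. r k (a k)) \<longlonglongrightarrow> 0"
    using r0 by (intro order_tendstoI) (auto intro!: always_eventually intro: less_le_trans)
  with that[of a] a(1) show thesis by (auto simp: S_def r_def)
qed

theorem dense_span_imp_representing_system:
  assumes e: "\<And>j. e j \<in> X" and dense: "dense_span e"
  obtains \<sigma> :: "nat \<Rightarrow> nat" where "representing_system X N (\<lambda>n. e (\<sigma> n))"
proof -
  \<comment> \<open>\<open>Q k\<close> will bound an incomplete repetition in block \<open>k\<close>
    before the division by \<open>M k\<close>; the factor \<open>2 * real k + 1\<close> is the sum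
    of the coefficient bounds \<open>k + 1\<close> and \<open>k\<close>. Only \<open>e\<close>
    enters into \<open>Q\<close> and \<open>M\<close>, so the order of the system is fixed before
    \<open>f\<close> is given.\<close>
  define Q where "Q k = (2 * real k + 1) * (\<Sum>j<Suc k. N (e j))" for k
  define M where "M k = Suc (nat \<lceil>real (Suc k) * Q k\<rceil>)" for k
  have Q0: "0 \<le> Q k" for k
    unfolding Q_def by (intro mult_nonneg_nonneg sum_nonneg nonneg e) auto
  have QM: "Q k / real (M k) \<le> 1 / real (Suc k)" for k
  proof -
    have "real (Suc k) * Q k \<le> real (M k)" unfolding M_def by linarith
    then show ?thesis by (simp add: M_def field_simps)
  qed
  have M0: "0 < M k * Suc k" for k by (simp add: M_def)
  define T where "T k = (\<Sum>i<k. M i * Suc i)" for k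
  obtain B where B: "\<And>n. T (B n) \<le> n" "\<And>n. n < T (B n) + M (B n) * Suc (B n)"
    "\<And>k i. i < M k * Suc k \<Longrightarrow> B (T k + i) = k" "filterlim B at_top sequentially"
    by (rule block_decomposition[of "\<lambda>k. M k * Suc k", OF M0, folded T_def]) blast
  \<comment> \<open>Inside block \<open>k\<close> the position is reduced modulo
    \<open>Suc k\<close>, so that \<open>\<tau>\<close> cycles through \<open>0, ..., k\<close>.
    Positions count from 0 here.\<close>
  define \<tau> where "\<tau> n = (n - T (B n)) mod Suc (B n)" for n
  have "\<exists>c. (\<lambda>m. N (\<lambda>z. f z - (\<Sum>n=1..m. c n * e (\<tau> (n - 1)) z))) \<longlonglongrightarrow> 0" if f: "f \<in> X" for f
  proof -
    obtain a where a: "\<And>k j. cmod (a k j) \<le> real k" "\<And>k j. k \<le> j \<Longrightarrow> a k j = 0"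
      "(\<lambda>k. N (\<lambda>z. f z - (\<Sum>j<k. a k j * e j z))) \<longlonglongrightarrow> 0"
      by (rule bounded_approximants[OF e dense f]) blast
    define y where "y k z = (\<Sum>j<k. a k j * e j z)" for k z
    define d where "d k j = a (Suc k) j - a k j" for k j
    define c where "c n = d (B n) (\<tau> n) / of_nat (M (B n))" for n
    have y_mem: "y k \<in> X" for k unfolding y_def by (intro sum_mem e)
    \<comment> \<open>The top index \<open>k\<close> adds nothing to \<open>y k\<close>, since
      \<open>a k k = 0\<close>.\<close>
    have d_sum: "(\<Sum>j<Suc k. d k j * e j z) = y (Suc k) z - y k z" for k z
      unfolding y_def d_def using a(2)[of k k]
      by (simp add: algebra_simps sum_subtractf)
    \<comment> \<open>Here \<open>s\<close> counts the complete repetitions, each contributing the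
      fraction \<open>1 / M k\<close> of \<open>y (Suc k) - y k\<close>, and \<open>t\<close> the
      terms of the repetition under way.\<close>
    have block: "(\<Sum>i<s * Suc k + t. c (T k + i) * e (\<tau> (T k + i)) z) =
        of_nat s / of_nat (M k) * (y (Suc k) z - y k z) + 1 / of_nat (M k) * (\<Sum>j<t. d k j * e j z)"
      if "t \<le> Suc k" "s * Suc k + t \<le> M k * Suc k" for s t k z
    proof -
      have "(\<Sum>i<s * Suc k + t. c (T k + i) * e (\<tau> (T k + i)) z) =
          (\<Sum>i<s * Suc k + t. 1 / of_nat (M k) * (d k (i mod Suc k) * e (i mod Suc k) z))"
        using that(2) by (intro sum.cong) (auto simp: c_def \<tau>_def B(3))
      also have "\<dots> = 1 / of_nat (M k) *
          (of_nat s * (\<Sum>j<Suc k. d k j * e j z) + (\<Sum>j<t. d k j * e j z))"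
        using sum_mod_periodic[OF that(1), of "\<lambda>j. d k j * e j z" s]
        by (simp only: sum_distrib_left[symmetric])
      finally show ?thesis unfolding d_sum by (simp add: algebra_simps)
    qed
    \<comment> \<open>Complete blocks telescope from \<open>y 0 = 0\<close>: block \<open>k\<close>
      is the case \<open>s = M k\<close>, \<open>t = 0\<close>.\<close>
    have full: "(\<Sum>n<T k. c n * e (\<tau> n) z) = y k z" for k z
    proof (induction k)
      case 0
      then show ?case by (simp add: T_def y_def)
    next
      case (Suc k)
      have "(\<Sum>n<T (Suc k). c n * e (\<tau> n) z) =
          y k z + (\<Sum>i<M k * Suc k + 0. c (T k + i) * e (\<tau> (T k + i)) z)"
        using sum_lessThan_add[of "\<lambda>n. c n * e (\<tau> n) z" "T k" "M k * Suc k"] Suc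
        by (simp add: T_def)
      also have "\<dots> = y (Suc k) z"
        by (subst block) (simp_all add: M_def del: of_nat_Suc)
      finally show ?case .
    qed
    define \<rho> where "\<rho> k = N (\<lambda>z. f z - y k z)" for k
    have bound: "N (\<lambda>z. f z - (\<Sum>n<m. c n * e (\<tau> n) z)) \<le>
        \<rho> (B m) + \<rho> (Suc (B m)) + 1 / real (Suc (B m))" for m
    proof -
      define k where "k = B m"
      define s where "s = (m - T k) div Suc k"
      define t where "t = (m - T k) mod Suc k"
      have m: "m = T k + (s * Suc k + t)"
        using B(1)[of m] by (simp add: s_def t_def k_def del: mult_Suc_right)
      have t: "t < Suc k" by (simp add: t_def)
      have le: "s * Suc k + t < M k * Suc k" using B(2)[of m, folded k_def] m by linarith
      then have "s * Suc k < M k * Suc k" by (rule le_less_trans[OF le_add1])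
      then have s: "s \<le> M k" unfolding mult_less_cancel2 by simp
      define h where "h z = (\<Sum>j<t. d k j * e j z)" for z
      have h: "h \<in> X" unfolding h_def by (intro sum_mem e)
      have dk: "cmod (d k j) \<le> 2 * real k + 1" for j
        using a(1)[of "Suc k" j] a(1)[of k j] norm_triangle_ineq4[of "a (Suc k) j" "a k j"]
        by (simp add: d_def)
      have "N h \<le> (\<Sum>j<t. cmod (d k j) * N (e j))"
        unfolding h_def by (intro norm_sum_le e)
      also have "\<dots> \<le> (\<Sum>j<t. (2 * real k + 1) * N (e j))"
        using dk by (intro sum_mono mult_right_mono nonneg e)
      also have "\<dots> \<le> (\<Sum>j<Suc k. (2 * real k + 1) * N (e j))"
        using t nonneg[OF e] by (intro sum_mono2) auto
      also have "\<dots> = Q k" by (simp add: Q_def sum_distrib_left distrib_left)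
      finally have "N h / real (M k) \<le> Q k / real (M k)" by (simp add: divide_right_mono)
      then have Nh: "N h / real (M k) \<le> 1 / real (Suc k)" using QM[of k] by linarith
      \<comment> \<open>\<open>q\<close> is the completed fraction of the block. It lies between 0
        and 1, so the error is a convex combination of the errors of \<open>y k\<close> and
        \<open>y (Suc k)\<close>, up to \<open>h / M k\<close>.\<close>
      define q :: complex where "q = of_nat s / of_nat (M k)"
      have q: "q = of_real (real s / real (M k))" by (simp add: q_def)
      have q01: "cmod q \<le> 1" "cmod (1 - q) \<le> 1"
      proof -
        have "0 \<le> real s / real (M k)" "real s / real (M k) \<le> 1"
          using s by (simp_all add: M_def del: of_nat_Suc)
        moreover have "1 - q = of_real (1 - real s / real (M k))" by (simp add: q)
        ultimately show "cmod q \<le> 1" "cmod (1 - q) \<le> 1" by (simp_all only: q norm_of_real)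
      qed
      have "(\<Sum>n<m. c n * e (\<tau> n) z) = y k z + (q * (y (Suc k) z - y k z) + 1 / of_nat (M k) * h z)"
        for z
        unfolding m sum_lessThan_add[of _ "T k" "s * Suc k + t"] full q_def h_def
        using t le by (subst block) auto
      then have "N (\<lambda>z. f z - (\<Sum>n<m. c n * e (\<tau> n) z)) =
          N (\<lambda>z. (1 - q) * (f z - y k z) + q * (f z - y (Suc k) z) + (- 1 / of_nat (M k)) * h z)"
        by (simp only:) (simp add: algebra_simps)
      also have "\<dots> \<le> \<rho> k + \<rho> (Suc k) + cmod (- 1 / of_nat (M k)) * N h"
        unfolding \<rho>_def by (intro convex_lincomb_le diff_mem f y_mem h q01)
      also have "cmod (- 1 / of_nat (M k)) * N h \<le> 1 / real (Suc k)"
        using Nh by (simp add: norm_divide)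
      finally show ?thesis by (simp add: k_def)
    qed
    have "\<rho> \<longlonglongrightarrow> 0" using a(3) by (simp add: \<rho>_def[abs_def] y_def)
    then have "(\<lambda>k. \<rho> k + \<rho> (Suc k) + 1 / real (Suc k)) \<longlonglongrightarrow> 0 + 0 + 0"
      by (intro tendsto_add LIMSEQ_Suc[OF lim_1_over_n] LIMSEQ_Suc)
    then have lim: "(\<lambda>m. \<rho> (B m) + \<rho> (Suc (B m)) + 1 / real (Suc (B m))) \<longlonglongrightarrow> 0"
      using filterlim_compose[OF _ B(4)] by force
    have "(\<lambda>m. N (\<lambda>z. f z - (\<Sum>n<m. c n * e (\<tau> n) z))) \<longlonglongrightarrow> 0"
      by (rule tendsto_sandwich[OF _ _ tendsto_const lim])
        (intro always_eventually allI bound nonneg diff_mem sum_mem f e)+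
    \<comment> \<open>Representing systems are indexed from 1, hence the shift by one.\<close>
    then show ?thesis
      by (intro exI[of _ "\<lambda>n. c (n - 1)"]) (simp add: sum.atLeast1_atMost_eq)
  qed
  with that[of "\<lambda>n. \<tau> (n - 1)"] e show thesis by (simp add: representing_system_def)
qed

end

section \<open>The weighted Hardy space as a seminormed function space\<close>

lemma weighted_l2_triangle:
  fixes a b :: "nat \<Rightarrow> complex"
  assumes pos: "\<And>n. 0 < \<beta> n" and a: "summable (\<lambda>n. (cmod (a n))\<^sup>2 * \<beta> n)"
    and b: "summable (\<lambda>n. (cmod (b n))\<^sup>2 * \<beta> n)"
    and ab: "summable (\<lambda>n. (cmod (a n + b n))\<^sup>2 * \<beta> n)"
  shows "sqrt (\<Sum>n. (cmod (a n + b n))\<^sup>2 * \<beta> n) \<le>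
    sqrt (\<Sum>n. (cmod (a n))\<^sup>2 * \<beta> n) + sqrt (\<Sum>n. (cmod (b n))\<^sup>2 * \<beta> n)"
proof -
  \<comment> \<open>Minkowski's inequality for finite sums, with \<open>sqrt (\<beta> i)\<close>
    absorbed into the terms; the claim follows by letting the number of terms grow.\<close>
  define S where "S c n = sqrt (\<Sum>i<n. (cmod (c i))\<^sup>2 * \<beta> i)" for c :: "nat \<Rightarrow> complex" and n
  have S: "S c n = L2_set (\<lambda>i. cmod (c i) * sqrt (\<beta> i)) {..<n}" for c n
    using pos by (simp add: S_def L2_set_def power_mult_distrib less_imp_le)
  have lim: "S c \<longlonglongrightarrow> sqrt (\<Sum>n. (cmod (c n))\<^sup>2 * \<beta> n)"
    if "summable (\<lambda>n. (cmod (c n))\<^sup>2 * \<beta> n)" for c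
    unfolding S_def by (intro tendsto_real_sqrt summable_LIMSEQ that)
  have "S (\<lambda>n. a n + b n) n \<le> S a n + S b n" for n
  proof -
    have "S (\<lambda>n. a n + b n) n \<le>
        L2_set (\<lambda>i. cmod (a i) * sqrt (\<beta> i) + cmod (b i) * sqrt (\<beta> i)) {..<n}"
      unfolding S using pos
      by (intro L2_set_mono) (auto simp: distrib_right[symmetric] less_imp_le intro!: mult_right_mono norm_triangle_ineq)
    also have "\<dots> \<le> S a n + S b n" unfolding S by (rule L2_set_triangle_ineq)
    finally show ?thesis .
  qed
  then show ?thesis
    by (intro LIMSEQ_le[OF lim[OF ab] tendsto_add[OF lim[OF a] lim[OF b]]]) auto
qed

lemma weighted_hardyE:
  assumes "f \<in> weighted_hardy \<beta>"
  obtains a where "summable (\<lambda>n. (cmod (a n))\<^sup>2 * \<beta> n)"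
    "\<And>z. z \<in> ball 0 1 \<Longrightarrow> (\<lambda>n. a n * z ^ n) sums f z"
    "hardy_norm \<beta> f = sqrt (\<Sum>n. (cmod (a n))\<^sup>2 * \<beta> n)"
  using assms hardy_norm_eq unfolding weighted_hardy_def by blast

lemma weighted_hardy_function_seminorm:
  assumes pos: "\<And>n. 0 < \<beta> n"
  shows "function_seminorm (weighted_hardy \<beta>) (hardy_norm \<beta>)"
proof
  show "(\<lambda>_. 0) \<in> weighted_hardy \<beta>"
    unfolding weighted_hardy_def by (auto intro!: exI[of _ "\<lambda>_. 0"])
next
  fix f g c d assume "f \<in> weighted_hardy \<beta>" "g \<in> weighted_hardy \<beta>"
  then show "(\<lambda>z. c * f z + d * g z) \<in> weighted_hardy \<beta>"
    using pos by (rule weighted_hardy_lincomb)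
next
  fix f g assume fg: "f \<in> weighted_hardy \<beta>" "g \<in> weighted_hardy \<beta>"
  obtain a where a: "summable (\<lambda>n. (cmod (a n))\<^sup>2 * \<beta> n)"
    "\<And>z. z \<in> ball 0 1 \<Longrightarrow> (\<lambda>n. a n * z ^ n) sums f z"
    "hardy_norm \<beta> f = sqrt (\<Sum>n. (cmod (a n))\<^sup>2 * \<beta> n)"
    using fg(1) by (rule weighted_hardyE) blast
  obtain b where b: "summable (\<lambda>n. (cmod (b n))\<^sup>2 * \<beta> n)"
    "\<And>z. z \<in> ball 0 1 \<Longrightarrow> (\<lambda>n. b n * z ^ n) sums g z"
    "hardy_norm \<beta> g = sqrt (\<Sum>n. (cmod (b n))\<^sup>2 * \<beta> n)"
    using fg(2) by (rule weighted_hardyE) blast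
  have sums: "(\<lambda>n. (a n + b n) * z ^ n) sums (f z + g z)" if "z \<in> ball 0 1" for z
    using sums_add[OF a(2) b(2)] that by (simp add: distrib_right)
  have "(\<lambda>z. f z + g z) \<in> weighted_hardy \<beta>"
    using weighted_hardy_lincomb[OF fg pos, of 1 1] by simp
  then obtain c where c: "summable (\<lambda>n. (cmod (c n))\<^sup>2 * \<beta> n)"
    "\<And>z. z \<in> ball 0 1 \<Longrightarrow> (\<lambda>n. c n * z ^ n) sums (f z + g z)"
    "hardy_norm \<beta> (\<lambda>z. f z + g z) = sqrt (\<Sum>n. (cmod (c n))\<^sup>2 * \<beta> n)"
    by (rule weighted_hardyE) blast
  \<comment> \<open>Uniqueness of Taylor coefficients identifies the sequence supplied by membership
    with \<open>a + b\<close>, which gives the summability required by the triangle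
    inequality.\<close>
  have c_eq: "c = (\<lambda>n. a n + b n)"
    using fps_expansion_coeff_eq[OF c(2)] fps_expansion_coeff_eq[OF sums] by fastforce
  have norm_sum: "hardy_norm \<beta> (\<lambda>z. f z + g z) = sqrt (\<Sum>n. (cmod (a n + b n))\<^sup>2 * \<beta> n)"
    by (rule hardy_norm_eq) (rule sums)
  show "hardy_norm \<beta> (\<lambda>z. f z + g z) \<le> hardy_norm \<beta> f + hardy_norm \<beta> g"
    unfolding norm_sum a(3) b(3)
    using c(1) c_eq by (intro weighted_l2_triangle pos a b) simp
next
  fix f c assume "f \<in> weighted_hardy \<beta>"
  then obtain a where a: "summable (\<lambda>n. (cmod (a n))\<^sup>2 * \<beta> n)"
    "\<And>z. z \<in> ball 0 1 \<Longrightarrow> (\<lambda>n. a n * z ^ n) sums f z"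
    "hardy_norm \<beta> f = sqrt (\<Sum>n. (cmod (a n))\<^sup>2 * \<beta> n)"
    by (rule weighted_hardyE) blast
  have "(\<lambda>n. (c * a n) * z ^ n) sums (c * f z)" if "z \<in> ball 0 1" for z
    using sums_mult[OF a(2)[OF that], of c] by (simp add: mult.assoc)
  then have "hardy_norm \<beta> (\<lambda>z. c * f z) = sqrt (\<Sum>n. (cmod (c * a n))\<^sup>2 * \<beta> n)"
    by (rule hardy_norm_eq)
  then show "hardy_norm \<beta> (\<lambda>z. c * f z) = cmod c * hardy_norm \<beta> f"
    using suminf_mult[OF a(1), of "(cmod c)\<^sup>2"]
    by (simp add: a(3) norm_mult power_mult_distrib real_sqrt_mult mult.assoc)
next
  fix f assume "f \<in> weighted_hardy \<beta>"
  then obtain a where a: "summable (\<lambda>n. (cmod (a n))\<^sup>2 * \<beta> n)"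
    "hardy_norm \<beta> f = sqrt (\<Sum>n. (cmod (a n))\<^sup>2 * \<beta> n)"
    by (metis weighted_hardyE)
  then show "0 \<le> hardy_norm \<beta> f"
    using pos by (auto intro!: suminf_nonneg simp: less_imp_le)
qed

section \<open>Kernels at equidistant points of a circle: Fourier sums, membership, density\<close>

lemma sum_roots_of_unity:
  fixes k :: int
  assumes "0 < N"
  shows "(\<Sum>j<N. cis (2 * pi * real j * of_int k / real N)) = (if int N dvd k then of_nat N else 0)"
proof -
  define x where "x = cis (2 * pi * of_int k / real N)"
  have pow: "cis (2 * pi * real j * of_int k / real N) = x ^ j" for j
    by (simp add: x_def Complex.DeMoivre mult_ac)
  have "x ^ N = cis (2 * pi * of_int k)" using assms by (simp add: x_def Complex.DeMoivre)
  then have xN: "x ^ N = 1" by (simp add: cis_multiple_2pi)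
  \<comment> \<open>\<open>x\<close> is an \<open>N\<close>-th root of unity, so the geometric sum
    of its powers vanishes unless \<open>x = 1\<close>.\<close>
  have "x = 1 \<longleftrightarrow> int N dvd k"
  proof
    assume "x = 1"
    then have "cos (2 * pi * of_int k / real N) = 1" by (simp add: x_def complex_eq_iff)
    then obtain m :: int where "2 * pi * of_int k / real N = of_int m * 2 * pi"
      by (auto simp: cos_one_2pi_int)
    then have "real_of_int k = of_int (m * int N)" using assms by (simp add: field_simps)
    then have "k = m * int N" using of_int_eq_iff by blast
    then show "int N dvd k" by simp
  next
    assume "int N dvd k"
    then obtain m where "k = int N * m" ..
    then have "2 * pi * of_int k / real N = 2 * pi * of_int m" using assms by simp
    then show "x = 1" by (simp only: x_def cis_multiple_2pi Ints_of_int)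
  qed
  then show ?thesis unfolding pow using xN geometric_sum[of x N] by auto
qed

text \<open>By Cauchy-Hadamard the limsup condition gives the power series with coefficients
  \<open>1 / \<beta> n\<close> radius of convergence at least 1. Taking
  \<open>r = cmod w * cmod z\<close> yields convergence of the kernel series, and
  \<open>r = (cmod w)\<^sup>2\<close> finiteness of the kernel norm.\<close>

lemma summable_inverse_weight:
  assumes pos: "\<And>n. 0 < \<beta> n"
    and "limsup (\<lambda>n. ereal (root n (1 / \<beta> n))) \<le> 1" and "0 \<le> r" "r < 1"
  shows "summable (\<lambda>n. r ^ n / \<beta> n)"
proof -
  have "conv_radius (\<lambda>n. 1 / \<beta> n) = inverse (limsup (\<lambda>n. ereal (root n (1 / \<beta> n))))"
    unfolding conv_radius_def using pos by (simp add: less_imp_le)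
  moreover have "0 \<le> limsup (\<lambda>n. ereal (root n (1 / \<beta> n)))"
    using pos by (intro le_Limsup) (auto simp: less_imp_le intro!: always_eventually real_root_ge_zero)
  ultimately have "1 \<le> conv_radius (\<lambda>n. 1 / \<beta> n)"
    using assms(2) ereal_inverse_antimono[of "limsup (\<lambda>n. ereal (root n (1 / \<beta> n)))" 1]
    by (simp add: one_ereal_def)
  moreover have "ereal (norm r) < 1" using assms by simp
  ultimately have "ereal (norm r) < conv_radius (\<lambda>n. 1 / \<beta> n)" by (rule less_le_trans[rotated])
  from summable_in_conv_radius[OF this] show ?thesis by (simp add: mult.commute)
qed

lemma hardy_kernel_sums:
  assumes pos: "\<And>n. 0 < \<beta> n"
    and lim: "limsup (\<lambda>n. ereal (root n (1 / \<beta> n))) \<le> 1"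
    and w: "w \<in> ball 0 1" and z: "z \<in> ball 0 1"
  shows "(\<lambda>n. cnj w ^ n / of_real (\<beta> n) * z ^ n) sums hardy_kernel \<beta> w z"
proof -
  have "cmod w * cmod z < 1" using w z mult_strict_mono[of "cmod w" 1 "cmod z" 1] by simp
  then have "summable (\<lambda>n. (cmod w * cmod z) ^ n / \<beta> n)"
    by (intro summable_inverse_weight[OF pos lim]) auto
  then have "summable (\<lambda>n. norm (cnj w ^ n / of_real (\<beta> n) * z ^ n))"
    using pos by (simp add: norm_mult norm_divide norm_power power_mult_distrib less_imp_le)
  then show ?thesis
    using z unfolding hardy_kernel_def by (auto intro: summable_sums dest: summable_norm_cancel)
qed

lemma hardy_kernel_mem:
  assumes pos: "\<And>n. 0 < \<beta> n"
    and lim: "limsup (\<lambda>n. ereal (root n (1 / \<beta> n))) \<le> 1" and w: "w \<in> ball 0 1"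
  shows "hardy_kernel \<beta> w \<in> weighted_hardy \<beta>"
proof -
  have "(cmod w)\<^sup>2 < 1" using w by (simp add: power_less_one_iff)
  then have "summable (\<lambda>n. ((cmod w)\<^sup>2) ^ n / \<beta> n)"
    by (intro summable_inverse_weight[OF pos lim]) auto
  also have "(\<lambda>n. ((cmod w)\<^sup>2) ^ n / \<beta> n) = (\<lambda>n. (cmod (cnj w ^ n / of_real (\<beta> n)))\<^sup>2 * \<beta> n)"
    using pos by (auto simp: norm_divide norm_power power_divide power2_eq_square power_mult_distrib
        less_imp_le less_imp_neq[symmetric])
  finally show ?thesis
    using hardy_kernel_sums[OF pos lim w] unfolding weighted_hardy_def
    by (intro CollectI conjI exI[of _ "\<lambda>n. cnj w ^ n / of_real (\<beta> n)"]) (auto simp: hardy_kernel_def)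
qed

text \<open>Divided by \<open>\<beta> i\<close>, these sums are the Taylor coefficients of a
  combination of kernels. With \<open>c\<close> a discrete Fourier transform of \<open>g\<close>,
  orthogonality of the roots of unity leaves \<open>r ^ i\<close> times the sum of those
  \<open>g m\<close> with \<open>m\<close> congruent to \<open>i\<close> modulo \<open>N\<close>.
  For \<open>i < N\<close> only \<open>m = i\<close> can occur; for larger \<open>i\<close> the
  values of \<open>g\<close> recur by aliasing. The factor \<open>\<Sum>m<n. cmod (g m)\<close> in
  the last bound does not depend on \<open>N\<close>.\<close>

lemma kernel_combination_on_circle:
  fixes g :: "nat \<Rightarrow> complex"
  assumes "n \<le> N" "0 < N"
  obtains c :: "nat \<Rightarrow> complex"
  where "\<And>i. i < n \<Longrightarrow> (\<Sum>j<N. c j * cnj (of_real r * cis (2 * pi * real j / real N)) ^ i) = of_real r ^ i * g i"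
    "\<And>i. n \<le> i \<Longrightarrow> i < N \<Longrightarrow> (\<Sum>j<N. c j * cnj (of_real r * cis (2 * pi * real j / real N)) ^ i) = 0"
    "\<And>i. cmod (\<Sum>j<N. c j * cnj (of_real r * cis (2 * pi * real j / real N)) ^ i) \<le> \<bar>r\<bar> ^ i * (\<Sum>m<n. cmod (g m))"
proof -
  define c where "c j = (\<Sum>m<n. g m * cis (2 * pi * real j * real m / real N)) / of_nat N" for j
  define s where "s i = (\<Sum>m<n. if int N dvd int m - int i then g m else 0)" for i
  have eq: "(\<Sum>j<N. c j * cnj (of_real r * cis (2 * pi * real j / real N)) ^ i) = of_real r ^ i * s i" for i
  proof -
    have "c j * cnj (of_real r * cis (2 * pi * real j / real N)) ^ i =
        (\<Sum>m<n. of_real r ^ i * g m / of_nat N * cis (2 * pi * real j * of_int (int m - int i) / real N))" for j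
    proof -
      have pow: "cnj (of_real r * cis (2 * pi * real j / real N)) ^ i =
          of_real r ^ i * cis (- (2 * pi * real j * real i / real N))"
        by (simp add: cis_cnj power_mult_distrib Complex.DeMoivre mult_ac)
      have mult: "cis (2 * pi * real j * real m / real N) * cis (- (2 * pi * real j * real i / real N)) =
          cis (2 * pi * real j * of_int (int m - int i) / real N)" for m
        by (simp add: cis_mult diff_divide_distrib right_diff_distrib)
      show ?thesis
        unfolding c_def pow mult[symmetric] sum_divide_distrib sum_distrib_right
        by (intro sum.cong) simp_all
    qed
    then have "(\<Sum>j<N. c j * cnj (of_real r * cis (2 * pi * real j / real N)) ^ i) =
        (\<Sum>m<n. \<Sum>j<N. of_real r ^ i * g m / of_nat N * cis (2 * pi * real j * of_int (int m - int i) / real N))"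
      by (simp only:) (rule sum.swap)
    also have "\<dots> = (\<Sum>m<n. of_real r ^ i * g m / of_nat N * (if int N dvd int m - int i then of_nat N else 0))"
      by (simp only: sum_distrib_left[symmetric] sum_roots_of_unity[OF \<open>0 < N\<close>])
    also have "\<dots> = of_real r ^ i * s i"
      unfolding s_def sum_distrib_left using \<open>0 < N\<close> by (intro sum.cong) auto
    finally show ?thesis .
  qed
  have dvd: "int N dvd int m - int i \<longleftrightarrow> m = i" if "m < n" "i < N" for m i
  proof
    assume "int N dvd int m - int i"
    then have "int m mod int N = int i mod int N" by (simp add: mod_eq_dvd_iff)
    then show "m = i" using that \<open>n \<le> N\<close> by simp
  qed simp
  have s: "s i = (if i < n then g i else 0)" if "i < N" for i
  proof -
    have "s i = (\<Sum>m<n. if m = i then g m else 0)"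
      unfolding s_def using dvd that by (intro sum.cong) auto
    then show ?thesis by simp
  qed
  have sb: "cmod (s i) \<le> (\<Sum>m<n. cmod (g m))" for i
    unfolding s_def by (intro sum_norm_le) auto
  show thesis
  proof (rule that[of c])
    fix i assume "i < n"
    then show "(\<Sum>j<N. c j * cnj (of_real r * cis (2 * pi * real j / real N)) ^ i) = of_real r ^ i * g i"
      unfolding eq using s assms by simp
  next
    fix i assume "n \<le> i" "i < N"
    then show "(\<Sum>j<N. c j * cnj (of_real r * cis (2 * pi * real j / real N)) ^ i) = 0"
      unfolding eq using s by simp
  next
    fix i
    show "cmod (\<Sum>j<N. c j * cnj (of_real r * cis (2 * pi * real j / real N)) ^ i) \<le> \<bar>r\<bar> ^ i * (\<Sum>m<n. cmod (g m))"
      unfolding eq using sb by (simp add: norm_mult norm_power mult_left_mono)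
  qed
qed

text \<open>The error is split by index: below \<open>n\<close> the coefficients agree, from
  \<open>n\<close> to \<open>N\<close> only those of \<open>f\<close> remain, and from
  \<open>N\<close> on both tails occur.\<close>

lemma kernels_on_circle_dense:
  assumes pos: "\<And>n. 0 < \<beta> n"
    and lim: "limsup (\<lambda>n. ereal (root n (1 / \<beta> n))) \<le> 1"
    and r: "0 < r" "r < 1" and f: "f \<in> weighted_hardy \<beta>" and \<epsilon>: "0 < \<epsilon>"
  shows "\<exists>N c. hardy_norm \<beta> (\<lambda>z. f z -
    (\<Sum>j<N. c j * hardy_kernel \<beta> (of_real r * cis (2 * pi * real j / real N)) z)) < \<epsilon>"
proof -
  obtain a where a: "summable (\<lambda>n. (cmod (a n))\<^sup>2 * \<beta> n)"
    "\<And>z. z \<in> ball 0 1 \<Longrightarrow> (\<lambda>n. a n * z ^ n) sums f z"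
    using f by (metis weighted_hardyE)
  have small_tail: "\<exists>n. (\<Sum>i. u (i + n)) < \<delta>"
    if u: "summable u" and \<delta>: "0 < \<delta>" for u :: "nat \<Rightarrow> real" and \<delta>
  proof -
    obtain n0 where "\<And>n. n0 \<le> n \<Longrightarrow> norm (\<Sum>i. u (i + n)) < \<delta>"
      using suminf_exist_split[OF \<delta> u] by blast
    from this[of n0] show ?thesis by (intro exI[of _ n0]) auto
  qed
  define A where "A i = (cmod (a i))\<^sup>2 * \<beta> i" for i
  define U where "U i = (r\<^sup>2) ^ i / \<beta> i" for i
  have A: "summable A" "\<And>i. 0 \<le> A i" using a(1) pos by (auto simp: A_def[abs_def] less_imp_le)
  have U: "summable U" "\<And>i. 0 \<le> U i"
    unfolding U_def[abs_def] using r pos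
    by (auto intro!: summable_inverse_weight[OF pos lim] simp: power_less_one_iff less_imp_le)
  obtain n where n: "(\<Sum>i. A (i + n)) < \<epsilon>\<^sup>2 / 4" using small_tail[OF A(1), of "\<epsilon>\<^sup>2 / 4"] \<epsilon> by auto
  \<comment> \<open>Chosen so that the factor \<open>r ^ m\<close> and the division by
    \<open>\<beta> m\<close> cancel, giving \<open>b m = a m\<close> for
    \<open>m < n\<close>.\<close>
  define g where "g m = a m * of_real (\<beta> m) / of_real r ^ m" for m
  define G where "G = (\<Sum>m<n. cmod (g m))"
  have "0 \<le> G" by (simp add: G_def sum_nonneg)
  \<comment> \<open>\<open>G\<close> depends on \<open>n\<close> but not on \<open>N\<close>, so
    \<open>N\<close> can still be taken large enough to make the aliased tail small.\<close>
  obtain N0 where N0: "(\<Sum>i. G\<^sup>2 * U (i + N0)) < \<epsilon>\<^sup>2 / 4"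
    using small_tail[of "\<lambda>i. G\<^sup>2 * U i" "\<epsilon>\<^sup>2 / 4"] \<epsilon> U(1) by (auto intro: summable_mult)
  define N where "N = Suc (max n N0)"
  have N: "n \<le> N" "0 < N" "N0 \<le> N" by (auto simp: N_def)
  define w where "w j = of_real r * cis (2 * pi * real j / real N)" for j :: nat
  have w: "w j \<in> ball 0 1" for j using r by (simp add: w_def norm_mult)
  obtain c where c: "\<And>i. i < n \<Longrightarrow> (\<Sum>j<N. c j * cnj (w j) ^ i) = of_real r ^ i * g i"
    "\<And>i. n \<le> i \<Longrightarrow> i < N \<Longrightarrow> (\<Sum>j<N. c j * cnj (w j) ^ i) = 0"
    "\<And>i. cmod (\<Sum>j<N. c j * cnj (w j) ^ i) \<le> \<bar>r\<bar> ^ i * G"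
    by (rule kernel_combination_on_circle[OF N(1,2), of r g, folded w_def G_def]) blast
  define b where "b i = (\<Sum>j<N. c j * cnj (w j) ^ i) / of_real (\<beta> i)" for i
  have b_sums: "(\<lambda>i. b i * z ^ i) sums (\<Sum>j<N. c j * hardy_kernel \<beta> (w j) z)" if "z \<in> ball 0 1" for z
  proof -
    have "(\<lambda>i. \<Sum>j<N. c j * (cnj (w j) ^ i / of_real (\<beta> i) * z ^ i)) sums
        (\<Sum>j<N. c j * hardy_kernel \<beta> (w j) z)"
      by (intro sums_sum sums_mult hardy_kernel_sums pos lim w that)
    then show ?thesis unfolding b_def sum_divide_distrib sum_distrib_right by (simp add: mult_ac)
  qed
  have b_bound: "(cmod (b i))\<^sup>2 * \<beta> i \<le> G\<^sup>2 * U i" for i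
  proof -
    have "(cmod (b i))\<^sup>2 * \<beta> i = (cmod (\<Sum>j<N. c j * cnj (w j) ^ i))\<^sup>2 / \<beta> i"
      using pos[of i] by (simp add: b_def norm_divide power_divide power2_eq_square)
    also have "\<dots> \<le> (\<bar>r\<bar> ^ i * G)\<^sup>2 / \<beta> i"
      using pos[of i] by (intro divide_right_mono power_mono c) auto
    also have "\<dots> = G\<^sup>2 * U i"
      using r by (simp add: U_def power_mult_distrib power_mult[symmetric] mult_ac)
    finally show ?thesis .
  qed
  \<comment> \<open>The factor 2 comes from the square of a sum being at most twice the sum of
    squares. Each tail is below \<open>\<epsilon>\<^sup>2 / 4\<close>, so \<open>V\<close> sums to
    less than \<open>\<epsilon>\<^sup>2\<close>. Cutting at \<open>N0 \<le> N\<close> is safe: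
    \<open>b i\<close> vanishes for \<open>n \<le> i < N\<close> and \<open>U\<close> is
    nonnegative.\<close>
  define V where "V i = 2 * ((if i < n then 0 else A i) + (if i < N0 then 0 else G\<^sup>2 * U i))" for i
  have d_le: "(cmod (a i - b i))\<^sup>2 * \<beta> i \<le> V i" for i
  proof (cases "i < n")
    case True
    then have "b i = a i" using c(1)[of i] pos[of i] r by (simp add: b_def g_def)
    then show ?thesis using True U(2) by (simp add: V_def)
  next
    case False
    have "(cmod (b i))\<^sup>2 * \<beta> i \<le> (if i < N0 then 0 else G\<^sup>2 * U i)"
      using b_bound[of i] c(2)[of i] False N by (auto simp: b_def)
    moreover have "(cmod (a i - b i))\<^sup>2 * \<beta> i \<le> 2 * A i + 2 * ((cmod (b i))\<^sup>2 * \<beta> i)"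
    proof -
      have "(cmod (a i - b i))\<^sup>2 \<le> (cmod (a i) + cmod (b i))\<^sup>2"
        by (intro power_mono norm_triangle_ineq4) auto
      also have "\<dots> \<le> 2 * (cmod (a i))\<^sup>2 + 2 * (cmod (b i))\<^sup>2"
        using sum_squares_bound[of "cmod (a i)" "cmod (b i)"] by (simp add: power2_sum)
      finally show ?thesis
        using mult_right_mono[of _ _ "\<beta> i"] pos[of i] by (fastforce simp: A_def algebra_simps)
    qed
    ultimately show ?thesis using False by (simp add: V_def)
  qed
  have tail: "(\<lambda>i. if i < k then 0 else u i) sums (\<Sum>i. u (i + k))"
    if "summable u" for u :: "nat \<Rightarrow> real" and k
  proof -
    have "(\<lambda>i. u (i + k)) sums (\<Sum>i. u (i + k))"
      using that by (intro summable_sums) (simp add: summable_iff_shift)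
    then have "(\<lambda>i. if i + k < k then 0 else u (i + k)) sums (\<Sum>i. u (i + k))" by simp
    then show ?thesis by (subst (asm) sums_iff_shift) simp
  qed
  have V: "V sums (2 * ((\<Sum>i. A (i + n)) + (\<Sum>i. G\<^sup>2 * U (i + N0))))"
    unfolding V_def by (intro sums_mult sums_add tail A U summable_mult)
  have d: "summable (\<lambda>i. (cmod (a i - b i))\<^sup>2 * \<beta> i)"
    using d_le pos by (intro summable_comparison_test'[OF sums_summable[OF V], of 0]) (auto simp: less_imp_le)
  have "(\<Sum>i. (cmod (a i - b i))\<^sup>2 * \<beta> i) \<le> suminf V"
    by (intro suminf_le d_le d sums_summable[OF V])
  also have "\<dots> < \<epsilon>\<^sup>2" using sums_unique[OF V] n N0 by simp
  finally have small: "sqrt (\<Sum>i. (cmod (a i - b i))\<^sup>2 * \<beta> i) < \<epsilon>"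
    using \<epsilon> by (intro real_less_lsqrt) auto
  have "(\<lambda>i. (a i - b i) * z ^ i) sums (f z - (\<Sum>j<N. c j * hardy_kernel \<beta> (w j) z))"
    if "z \<in> ball 0 1" for z
    using sums_diff[OF a(2) b_sums] that by (simp add: left_diff_distrib)
  then have "hardy_norm \<beta> (\<lambda>z. f z - (\<Sum>j<N. c j * hardy_kernel \<beta> (w j) z)) =
      sqrt (\<Sum>i. (cmod (a i - b i))\<^sup>2 * \<beta> i)"
    by (rule hardy_norm_eq)
  with small show ?thesis
    unfolding w_def by (intro exI[of _ N] exI[of _ c]) simp
qed

theorem theorem1p2:
  fixes \<beta> :: "nat \<Rightarrow> real"
  assumes "\<And>n. 0 < \<beta> n"
    and "limsup (\<lambda>n. ereal (root n (1 / \<beta> n))) \<le> 1"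
    and "limsup (\<lambda>n. ereal (root n (\<beta> n))) \<le> 1"
  shows "\<exists>w :: nat \<Rightarrow> complex. (\<forall>n\<ge>1. w n \<in> ball 0 1) \<and>
           representing_system (weighted_hardy \<beta>) (hardy_norm \<beta>) (\<lambda>n. hardy_kernel \<beta> (w n))"
proof -
  interpret function_seminorm "weighted_hardy \<beta>" "hardy_norm \<beta>"
    by (rule weighted_hardy_function_seminorm) (rule assms)
  \<comment> \<open>All pairs \<open>(N, j)\<close> are enumerated, so one sequence contains the
    equidistant points for every \<open>N\<close>. For \<open>N = 0\<close> the quotient is 0 and
    the point is 1/2, still in the disk.\<close>
  define w :: "nat \<Rightarrow> complex" where
    "w = (\<lambda>(N, j). of_real (1 / 2) * cis (2 * pi * real j / real N)) \<circ> prod_decode"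
  have w: "w k \<in> ball 0 1" for k by (simp add: w_def norm_mult split: prod.split)
  have mem: "hardy_kernel \<beta> (w k) \<in> weighted_hardy \<beta>" for k
    by (intro hardy_kernel_mem assms w)
  have "dense_span (\<lambda>k. hardy_kernel \<beta> (w k))"
    unfolding dense_span_def
  proof (intro ballI allI impI)
    fix f and \<epsilon> :: real assume "f \<in> weighted_hardy \<beta>" "0 < \<epsilon>"
    then obtain N c where Nc: "hardy_norm \<beta> (\<lambda>z. f z - (\<Sum>j<N. c j *
        hardy_kernel \<beta> (of_real (1 / 2) * cis (2 * pi * real j / real N)) z)) < \<epsilon>"
      using kernels_on_circle_dense[OF assms(1,2), of "1 / 2" f \<epsilon>] by auto
    \<comment> \<open>\<open>?A\<close> consists of the codes of the \<open>N\<close> points used,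
      and \<open>?c\<close> recovers \<open>j\<close> from a code.\<close>
    let ?A = "(\<lambda>j. prod_encode (N, j)) ` {..<N}"
    let ?c = "\<lambda>k. c (snd (prod_decode k))"
    have "inj_on (\<lambda>j. prod_encode (N, j)) {..<N}" by (auto simp: inj_on_def)
    then have "(\<Sum>k\<in>?A. ?c k * hardy_kernel \<beta> (w k) z) = (\<Sum>j<N. c j *
        hardy_kernel \<beta> (of_real (1 / 2) * cis (2 * pi * real j / real N)) z)" for z
      by (simp add: sum.reindex w_def)
    with Nc show "\<exists>A c. finite A \<and> hardy_norm \<beta> (\<lambda>z. f z - (\<Sum>j\<in>A. c j * hardy_kernel \<beta> (w j) z)) < \<epsilon>"
      by (intro exI[of _ ?A] exI[of _ ?c]) simp
  qed
  then obtain \<sigma> where "representing_system (weighted_hardy \<beta>) (hardy_norm \<beta>) (\<lambda>n. hardy_kernel \<beta> (w (\<sigma> n)))"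
    by (rule dense_span_imp_representing_system[of "\<lambda>k. hardy_kernel \<beta> (w k)", OF mem]) blast
  with w show ?thesis by (intro exI[of _ "w \<circ> \<sigma>"]) simp
qed

end
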